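(* Let $k\ge1$, $d$, $n$ be such that $n=\Omega(d^{2/k})$. Then any $k$-dimensional $(d,\delta)$-LPHS satisfies $\delta=\Omega(d^{-2/k})$.
   Context: Let $\Sigma_b=\{0,1\}^b$. A $k$-dimensional input is $x\in\Sigma_b^{\mathbb{Z}_n^k}$. For $r\in\mathbb{Z}_n^k$, $x\ll r$ is the cyclic shift $(x\ll r)[j]=x[j+r]$ (coordinatewise mod $n$). A $k$-dimensional $(d,\delta)$-LPHS is a function $h:\Sigma_b^{\mathbb{Z}_n^k}\to\mathbb{Z}_n^k$ that can be computed by making $d$ adaptive queries to entries of its input, such that for every unit vector $e_i\in\mathbb{Z}_n^k$, $\Pr_x[h(x)\neq h(x\ll e_i)+e_i]\le\delta$ for $x$ uniformly random (and over $h$'s internal randomness if $h$ is randomized, the randomness being shared between the two evaluations). *)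

theory Defs
  imports "HOL-Probability.Probability"
begin

text \<open>The torus $\mathbb{Z}_n^k$, with coordinates represented by residues in $\{0,\dots,n-1\}$.\<close>

definition torus :: "nat \<Rightarrow> nat \<Rightarrow> (nat \<Rightarrow> nat) set" where
  "torus k n = {..<k} \<rightarrow>\<^sub>E {..<n}"

definition torus_add :: "nat \<Rightarrow> nat \<Rightarrow> (nat \<Rightarrow> nat) \<Rightarrow> (nat \<Rightarrow> nat) \<Rightarrow> (nat \<Rightarrow> nat)" where
  "torus_add k n u v = (\<lambda>j\<in>{..<k}. (u j + v j) mod n)"

definition unit_vec :: "nat \<Rightarrow> nat \<Rightarrow> nat \<Rightarrow> (nat \<Rightarrow> nat)" where
  "unit_vec k n i = (\<lambda>j\<in>{..<k}. (if j = i then 1 else 0) mod n)"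

type_synonym input = "(nat \<Rightarrow> nat) \<Rightarrow> bool list"

definition inputs :: "nat \<Rightarrow> nat \<Rightarrow> nat \<Rightarrow> input set" where
  "inputs k n b = torus k n \<rightarrow>\<^sub>E {w. length w = b}"

definition shift :: "nat \<Rightarrow> nat \<Rightarrow> input \<Rightarrow> (nat \<Rightarrow> nat) \<Rightarrow> input" where
  "shift k n x r = (\<lambda>j\<in>torus k n. x (torus_add k n j r))"

text \<open>Adaptive query algorithms: the next query may depend on all previous answers.\<close>

datatype ('i, 'a, 'o) query_alg = Output 'o | Query 'i "'a \<Rightarrow> ('i, 'a, 'o) query_alg"

primrec run :: "('i, 'a, 'o) query_alg \<Rightarrow> ('i \<Rightarrow> 'a) \<Rightarrow> 'o" where
  "run (Output v) x = v"
| "run (Query i f) x = run (f (x i)) x"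

primrec query_seq :: "('i, 'a, 'o) query_alg \<Rightarrow> ('i \<Rightarrow> 'a) \<Rightarrow> 'i list" where
  "query_seq (Output v) x = []"
| "query_seq (Query i f) x = i # query_seq (f (x i)) x"

definition query_functions ::
  "nat \<Rightarrow> nat \<Rightarrow> nat \<Rightarrow> nat \<Rightarrow> (input \<Rightarrow> (nat \<Rightarrow> nat)) set" where
  "query_functions k n b d =
    {h \<in> inputs k n b \<rightarrow>\<^sub>E torus k n.
       \<exists>A. \<forall>x\<in>inputs k n b. run A x = h x \<and>
             set (query_seq A x) \<subseteq> torus k n \<and> length (query_seq A x) \<le> d}"

text \<open>
  A possibly randomized LPHS is a distribution \<open>H\<close> on deterministic query functions.
  There are only finitely many functions from inputs to the torus, so distributions of type
  \<open>pmf\<close> cover every source of randomness. One function drawn from \<open>H\<close>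
  is used in both evaluations; a deterministic LPHS \<open>h\<close> is the case \<open>return_pmf h\<close>.
\<close>

definition LPHS ::
  "nat \<Rightarrow> nat \<Rightarrow> nat \<Rightarrow> nat \<Rightarrow> real \<Rightarrow> (input \<Rightarrow> (nat \<Rightarrow> nat)) pmf \<Rightarrow> bool" where
  "LPHS k n b d \<delta> H \<longleftrightarrow>
     set_pmf H \<subseteq> query_functions k n b d \<and>
     (\<forall>i<k. measure_pmf.prob (pair_pmf H (pmf_of_set (inputs k n b)))
        {(h, x). h x \<noteq> torus_add k n (h (shift k n x (unit_vec k n i))) (unit_vec k n i)} \<le> \<delta>)"

lemma LPHS_deterministic:
  "LPHS k n b d \<delta> (return_pmf h) \<longleftrightarrow>
     h \<in> query_functions k n b d \<and>
     (\<forall>i<k. measure_pmf.prob (pmf_of_set (inputs k n b))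
        {x. h x \<noteq> torus_add k n (h (shift k n x (unit_vec k n i))) (unit_vec k n i)} \<le> \<delta>)"
  by (simp add: LPHS_def pair_return_pmf1 vimage_def)

end

theory Submission
  imports Defs
begin

text \<open>
  For an input \<open>x\<close>, the map \<open>r \<mapsto> h (x \<lless> r) + r\<close> labels the torus, and the error of \<open>h\<close> in
  direction \<open>i\<close> is the average fraction of edges in direction \<open>i\<close> whose ends get different labels.
  If the queries made at \<open>x\<close> and at \<open>x \<lless> r\<close> do not meet, the two labels behave like those of
  independent inputs \<open>x\<close>, \<open>y\<close>. Summing over all \<open>r\<close>, the queries at independent inputs meet for at
  most \<open>d\<^sup>2\<close> shifts and their labels agree for at most one, so the level set of a random point has
  expected size at most \<open>d\<^sup>2 + 1\<close>. By the Loomis--Whitney inequality a level set of size \<open>s\<close> cuts,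
  averaged over the directions, at least a fraction \<open>s powr (-1/k) - 1/n\<close> of its edges (the \<open>1/n\<close>
  accounts for full lines of the torus), and convexity of \<open>s powr (-1/k)\<close> gives a bound that is
  uniform in \<open>k\<close>.
\<close>

subsection \<open>Decoupling adaptive queries\<close>

text \<open>The clause \<open>Q z = Q x\<close> goes beyond the usual notion of a certificate: the
  positions read are themselves determined by the values found there. Adaptive querying guarantees
  this, and it makes exchanges of values reversible.\<close>

definition certificate :: "('i \<Rightarrow> 'a) set \<Rightarrow> (('i \<Rightarrow> 'a) \<Rightarrow> 'o) \<Rightarrow> (('i \<Rightarrow> 'a) \<Rightarrow> 'i set) \<Rightarrow> bool" where
  "certificate X f Q \<longleftrightarrow>
     (\<forall>x\<in>X. \<forall>z\<in>X. (\<forall>i\<in>Q x. z i = x i) \<longrightarrow> f z = f x \<and> Q z = Q x)"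

lemma certificateD:
  assumes "certificate X f Q" "x \<in> X" "z \<in> X" "\<And>i. i \<in> Q x \<Longrightarrow> z i = x i"
  shows "f z = f x" "Q z = Q x"
  using assms unfolding certificate_def by blast+

lemma query_seq_cong:
  assumes "\<And>i. i \<in> set (query_seq A x) \<Longrightarrow> z i = x i"
  shows "run A z = run A x \<and> query_seq A z = query_seq A x"
  using assms by (induction A) auto

definition splice_on :: "'i set \<Rightarrow> ('i \<Rightarrow> 'a) \<Rightarrow> ('i \<Rightarrow> 'a) \<Rightarrow> ('i \<Rightarrow> 'a)" where
  "splice_on S y x = (\<lambda>i. if i \<in> S then y i else x i)"

lemma splice_on_PiE:
  "x \<in> PiE I A \<Longrightarrow> y \<in> PiE I A \<Longrightarrow> splice_on S y x \<in> PiE I A"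
  by (auto simp: splice_on_def PiE_iff extensional_def)

text \<open>The factor \<open>card X\<close> supplies a spare input, so that passing from one input
  to an independent pair becomes a bijection between sets of pairs.\<close>

lemma decoupling:
  fixes I :: "'i set" and A :: "'i \<Rightarrow> 'a set"
  defines "X \<equiv> PiE I A"
  assumes f: "certificate X f Q" and g: "certificate X g R"
  shows "card {x \<in> X. P (f x) (g x) \<and> Q x \<inter> R x = {}} * card X =
         card {(x, y) \<in> X \<times> X. P (f x) (g y) \<and> Q x \<inter> R y = {}}"
proof -
  \<comment> \<open>Exchanging the two inputs on the certificate \<open>R\<close> is reversible, because that certificate stays visible.\<close>
  let ?L = "{x \<in> X. P (f x) (g x) \<and> Q x \<inter> R x = {}} \<times> X"
  let ?R = "{(x, y) \<in> X \<times> X. P (f x) (g y) \<and> Q x \<inter> R y = {}}"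
  let ?F = "\<lambda>(z, w). (splice_on (R z) w z, splice_on (R z) z w)"
  let ?G = "\<lambda>(x, y). (splice_on (R y) y x, splice_on (R y) x y)"
  have spl: "splice_on S y x \<in> X" if "x \<in> X" "y \<in> X" for x y S
    using that by (simp add: X_def splice_on_PiE)
  \<comment> \<open>A change outside \<open>Q x\<close> is invisible to \<open>f\<close>, whereas an
    input that receives the values of \<open>y\<close> on \<open>R y\<close> looks like
    \<open>y\<close> to \<open>g\<close>.\<close>
  have cert1: "f (splice_on S y x) = f x \<and> Q (splice_on S y x) = Q x"
    if "x \<in> X" "y \<in> X" "Q x \<inter> S = {}" for x y S
    using certificateD[OF f that(1) spl[OF that(1,2)], of S] that(3)
    by (auto simp: splice_on_def disjoint_iff)
  have cert2: "g (splice_on (R y) y x) = g y \<and> R (splice_on (R y) y x) = R y"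
    if "x \<in> X" "y \<in> X" for x y
    using certificateD[OF g that(2) spl[OF that], of "R y"]
    by (auto simp: splice_on_def)
  have cert3: "g (splice_on (R z) z w) = g z \<and> R (splice_on (R z) z w) = R z"
    if "z \<in> X" "w \<in> X" for z w
    using that by (intro cert2)
  have undo: "splice_on S (splice_on S x y) (splice_on S y x) = x"
    for S and x y :: "'i \<Rightarrow> 'a"
    by (auto simp: splice_on_def)
  have "bij_betw ?F ?L ?R"
  proof (rule bij_betw_byWitness[where f' = ?G])
    show "\<forall>p\<in>?L. ?G (?F p) = p"
      by (auto simp: cert3 undo)
    show "\<forall>p\<in>?R. ?F (?G p) = p"
      by (auto simp: cert2 undo)
    show "?F ` ?L \<subseteq> ?R"
      by (auto simp: cert1 cert3 spl)
    show "?G ` ?R \<subseteq> ?L"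
      by (auto simp: cert1 cert2 spl)
  qed
  from bij_betw_same_card[OF this] show ?thesis
    by (simp add: card_cartesian_product)
qed

lemma card_pairs_eq_sum:
  assumes "finite X" "finite Y"
  shows "card {(x, y) \<in> X \<times> Y. P x y} = (\<Sum>x\<in>X. \<Sum>y\<in>Y. of_bool (P x y))"
proof -
  have "card {(x, y) \<in> X \<times> Y. P x y} = (\<Sum>p\<in>X \<times> Y. of_bool (case p of (x, y) \<Rightarrow> P x y))"
    using assms by (subst sum_of_bool_eq) (auto intro!: arg_cong[where f = card])
  also have "\<dots> = (\<Sum>x\<in>X. \<Sum>y\<in>Y. of_bool (P x y))"
    by (simp add: sum.cartesian_product case_prod_unfold)
  finally show ?thesis .
qed

text \<open>A coincidence occurs either with meeting certificates or with disjoint ones, and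
  decoupling turns both cases into counts over independent pairs.\<close>

lemma coincidence_le:
  fixes I :: "'i set" and A :: "'i \<Rightarrow> 'a set"
  defines "X \<equiv> PiE I A"
  assumes fin: "finite X" and f: "certificate X f Q" and g: "certificate X g R"
  shows "card {x \<in> X. f x = g x} * card X \<le>
         (\<Sum>x\<in>X. \<Sum>y\<in>X. of_bool (Q x \<inter> R y \<noteq> {})) + (\<Sum>x\<in>X. \<Sum>y\<in>X. of_bool (f x = g y))"
proof -
  let ?N = "card X"
  let ?D = "{x \<in> X. Q x \<inter> R x = {}}" and ?M = "{x \<in> X. Q x \<inter> R x \<noteq> {}}"
  let ?D2 = "{(x, y) \<in> X \<times> X. Q x \<inter> R y = {}}" and ?M2 = "{(x, y) \<in> X \<times> X. Q x \<inter> R y \<noteq> {}}"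
  have "card ?D + card ?M = ?N"
    using fin by (subst card_Un_disjoint[symmetric]) (auto intro!: arg_cong[where f=card])
  then have 1: "card ?D * ?N + card ?M * ?N = ?N * ?N"
    by (metis add_mult_distrib)
  have fin2: "finite ?D2" "finite ?M2"
    by (rule finite_subset[of _ "X \<times> X"]; use fin in auto)+
  have "card ?D2 + card ?M2 = card (X \<times> X)"
    using fin2 by (subst card_Un_disjoint[symmetric]) (auto intro!: arg_cong[where f=card])
  \<comment> \<open>Decoupling speaks only of disjoint certificates. With the trivial predicate it
    compares the disjoint events, and complements then compare the meeting ones.\<close>
  moreover have "card ?D * ?N = card ?D2"
    using decoupling[OF f[unfolded X_def] g[unfolded X_def], of "\<lambda>_ _. True"] by (simp add: X_def)
  ultimately have 2: "card ?M * ?N = card ?M2"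
    using 1 by (simp add: card_cartesian_product)
  let ?E = "{x \<in> X. f x = g x \<and> Q x \<inter> R x = {}}"
  have "card {x \<in> X. f x = g x} \<le> card (?M \<union> ?E)"
    using fin by (intro card_mono) auto
  also have "\<dots> \<le> card ?M + card ?E" by (rule card_Un_le)
  finally have "card {x \<in> X. f x = g x} * ?N \<le> card ?M * ?N + card ?E * ?N"
    unfolding add_mult_distrib[symmetric] by (rule mult_le_mono1)
  also have "card ?E * ?N = card {(x, y) \<in> X \<times> X. f x = g y \<and> Q x \<inter> R y = {}}"
    using decoupling[OF f[unfolded X_def] g[unfolded X_def], of "(=)"] by (simp add: X_def)
  also have "\<dots> \<le> card {(x, y) \<in> X \<times> X. f x = g y}"
    by (rule card_mono[OF finite_subset[of _ "X \<times> X"]]) (use fin in auto)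
  finally show ?thesis
    unfolding 2 card_pairs_eq_sum[OF fin fin] by linarith
qed

subsection \<open>Shifts of the torus\<close>

lemma finite_torus: "finite (torus k n)"
  by (simp add: torus_def finite_PiE)

lemma torus_add_closed: "0 < n \<Longrightarrow> torus_add k n u v \<in> torus k n"
  by (auto simp: torus_def torus_add_def)

lemma torus_add_commute: "torus_add k n u v = torus_add k n v u"
  by (simp add: torus_add_def add.commute)

lemma torus_add_assoc:
  "torus_add k n (torus_add k n u v) w = torus_add k n u (torus_add k n v w)"
  by (auto simp: torus_add_def fun_eq_iff restrict_def mod_simps ac_simps)

lemma bij_betw_torus_add:
  assumes "0 < n"
  shows "bij_betw (\<lambda>u. torus_add k n u v) (torus k n) (torus k n)"
proof -
  have inj: "inj_on (\<lambda>u. torus_add k n u v) (torus k n)"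
  proof (intro inj_onI PiE_ext)
    fix u w assume u: "u \<in> torus k n" and w: "w \<in> torus k n"
      and eq: "torus_add k n u v = torus_add k n w v"
    show "u \<in> {..<k} \<rightarrow>\<^sub>E {..<n}" "w \<in> {..<k} \<rightarrow>\<^sub>E {..<n}"
      using u w by (auto simp: torus_def)
    fix j assume j: "j \<in> {..<k}"
    then have "(u j + v j) mod n = (w j + v j) mod n"
      using fun_cong[OF eq, of j] by (simp add: torus_add_def)
    then have "int (u j) mod int n = int (w j) mod int n"
      by (metis add_diff_cancel_right' mod_diff_left_eq of_nat_add of_nat_mod)
    moreover have "u j < n" "w j < n"
      using u w j by (auto simp: torus_def)
    ultimately show "u j = w j"
      by simp
  qed
  then show ?thesis
    using endo_inj_surj[of "torus k n" "\<lambda>u. torus_add k n u v"] torus_add_closed[OF assms]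
    by (simp add: bij_betw_def image_subset_iff finite_torus)
qed

lemma torus_add_right_cancel:
  assumes "0 < n" "u \<in> torus k n" "w \<in> torus k n"
  shows "torus_add k n u v = torus_add k n w v \<longleftrightarrow> u = w"
  using bij_betw_torus_add[OF assms(1), of k v] assms(2,3)
  by (auto simp: bij_betw_def inj_on_def)

lemma torus_add_left_cancel:
  assumes "0 < n" "u \<in> torus k n" "w \<in> torus k n"
  shows "torus_add k n v u = torus_add k n v w \<longleftrightarrow> u = w"
  using torus_add_right_cancel[OF assms, of v]
  by (simp only: torus_add_commute[of k n v u] torus_add_commute[of k n v w])

lemma finite_inputs: "finite (inputs k n b)"
  using finite_lists_length_eq[of "UNIV::bool set" b]
  by (simp add: inputs_def finite_PiE finite_torus)

lemma inputs_nonempty: "inputs k n b \<noteq> {}"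
proof -
  have "replicate b False \<in> {w. length w = b}" by simp
  then show ?thesis unfolding inputs_def PiE_eq_empty_iff by blast
qed

lemma shift_inputs:
  assumes "0 < n" "x \<in> inputs k n b"
  shows "shift k n x r \<in> inputs k n b"
  using assms(2) torus_add_closed[OF assms(1)] by (auto simp: shift_def inputs_def PiE_iff)

lemma shift_shift:
  assumes "0 < n"
  shows "shift k n (shift k n x r) s = shift k n x (torus_add k n r s)"
  using torus_add_closed[OF assms]
  by (auto simp: shift_def fun_eq_iff restrict_def torus_add_assoc torus_add_commute[of k n r s])

lemma bij_betw_shift:
  assumes "0 < n"
  shows "bij_betw (\<lambda>x. shift k n x r) (inputs k n b) (inputs k n b)"
proof -
  have inj: "inj_on (\<lambda>x. shift k n x r) (inputs k n b)"
  proof (rule inj_onI)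
    fix x y assume x: "x \<in> inputs k n b" and y: "y \<in> inputs k n b"
      and eq: "shift k n x r = shift k n y r"
    have "x j = y j" if "j \<in> torus k n" for j
    proof -
      have "j \<in> (\<lambda>u. torus_add k n u r) ` torus k n"
        unfolding bij_betw_imp_surj_on[OF bij_betw_torus_add[OF assms]] by (rule that)
      then obtain i where "i \<in> torus k n" "j = torus_add k n i r"
        by (rule imageE)
      then show ?thesis
        using fun_cong[OF eq, of i] by (simp add: shift_def)
    qed
    with x y show "x = y"
      unfolding inputs_def by (rule PiE_ext)
  qed
  then show ?thesis
    using endo_inj_surj[of "inputs k n b" "\<lambda>x. shift k n x r"] shift_inputs[OF assms]
    by (simp add: bij_betw_def image_subset_iff finite_inputs)
qed

subsection \<open>Edge isoperimetry\<close>

text \<open>Overwriting a coordinate by \<open>undefined\<close> keeps the type, and it moves a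
  subset of \<open>extensional (insert i I)\<close> into \<open>extensional I\<close>, as an
  induction on the dimension requires.\<close>

abbreviation proj_away :: "'i \<Rightarrow> ('i \<Rightarrow> 'a) set \<Rightarrow> ('i \<Rightarrow> 'a) set" where
  "proj_away i S \<equiv> (\<lambda>u. u(i := undefined)) ` S"

lemma card_eq_sum_fibres:
  "finite S \<Longrightarrow> card S = (\<Sum>y\<in>f ` S. card {x \<in> S. f x = y})"
  using sum.image_gen[of S "\<lambda>_. 1::nat" f] by simp

lemma inj_on_fun_upd_fibre: "inj_on (\<lambda>u. u(i := c)) {u \<in> S. u i = a}"
proof (rule inj_onI)
  fix u v assume "u \<in> {u \<in> S. u i = a}" "v \<in> {u \<in> S. u i = a}" "u(i := c) = v(i := c)"
  then show "u = v"
    by (metis (mono_tags, lifting) fun_upd_triv fun_upd_upd mem_Collect_eq)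
qed

text \<open>This is the arithmetic-mean form of Loomis-Whitney; the usual product form would give it
  by AM-GM. Here the sum form itself is carried through the induction, with a weighted AM-GM at each
  step.\<close>

lemma loomis_whitney_sum:
  assumes "finite I" "I \<noteq> {}" "finite S" "S \<noteq> {}" "S \<subseteq> extensional I"
  shows "real (card I) * real (card S) powr (1 - 1 / real (card I)) \<le>
         (\<Sum>i\<in>I. real (card (proj_away i S)))"
  using assms
proof (induction I arbitrary: S rule: finite_ne_induct)
  case (singleton i)
  \<comment> \<open>In dimension one the exponent is \<open>0\<close>, so nonemptiness
    suffices.\<close>
  then have "card (proj_away i S) > 0" "card S > 0"
    by (auto simp: card_gt_0_iff)
  moreover define P where "P j = real (card (proj_away j S))" for j
  ultimately have "real (card {i}) * real (card S) powr (1 - 1 / real (card {i})) \<le> (\<Sum>j\<in>{i}. P j)"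
    by simp
  then show ?case by (simp only: P_def)
next
  case (insert i I)
  note S = \<open>finite S\<close> \<open>S \<noteq> {}\<close> \<open>S \<subseteq> extensional (insert i I)\<close>
  \<comment> \<open>Induct on slices at fixed coordinate \<open>i\<close>: each slice is no larger than the projection along \<open>i\<close>.\<close>
  define m where "m = card I"
  define V where "V = (\<lambda>u. u i) ` S"
  define slice where "slice a = proj_away i {u \<in> S. u i = a}" for a
  define M where "M = card (proj_away i S)"
  have m: "m > 0"
    using insert.hyps by (simp add: m_def card_gt_0_iff)
  have fin_slice: "finite (slice a)" for a
    using S by (simp add: slice_def)
  have card_S: "card S = (\<Sum>a\<in>V. card (slice a))"
    using card_eq_sum_fibres[OF S(1), of "\<lambda>u. u i"] card_image[OF inj_on_fun_upd_fibre[of i undefined S]]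
    by (simp add: V_def slice_def)
  have slice_le: "card (slice a) \<le> M" for a
    unfolding slice_def M_def by (rule card_mono) (use S in auto)
  \<comment> \<open>Slicing at \<open>i\<close> commutes with projecting along another coordinate
    \<open>j\<close>, so the values of coordinate \<open>i\<close> partition the projection of
    \<open>S\<close> into copies of the projected slices.\<close>
  have proj_slices: "card (proj_away j S) = (\<Sum>a\<in>V. card (proj_away j (slice a)))" if "j \<in> I" for j
  proof -
    have ji: "i \<noteq> j" using that insert.hyps by auto
    then have V: "(\<lambda>u. u i) ` proj_away j S = V"
      by (simp add: V_def image_image)
    have "card {p \<in> proj_away j S. p i = a} = card (proj_away j (slice a))" for a
    proof -
      have "proj_away j (slice a) = proj_away i {p \<in> proj_away j S. p i = a}"
      proof (rule set_eqI)
        fix p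
        have "p \<in> proj_away j (slice a) \<longleftrightarrow> (\<exists>u\<in>S. u i = a \<and> p = (u(i := undefined))(j := undefined))"
          by (auto simp: slice_def)
        also have "\<dots> \<longleftrightarrow> (\<exists>u\<in>S. u i = a \<and> p = (u(j := undefined))(i := undefined))"
          using ji by (simp add: fun_upd_twist)
        also have "\<dots> \<longleftrightarrow> p \<in> proj_away i {p \<in> proj_away j S. p i = a}"
          using ji by auto
        finally show "p \<in> proj_away j (slice a) \<longleftrightarrow> \<dots>" .
      qed
      then show ?thesis
        by (simp only: card_image[OF inj_on_fun_upd_fibre])
    qed
    then show ?thesis
      using card_eq_sum_fibres[of "proj_away j S" "\<lambda>u. u i"] S by (simp only: V finite_imageI)
  qed
  \<comment> \<open>Writing \<open>c powr (1 - 1/m)\<close> as \<open>c * c powr (-1/m)\<close> and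
    using \<open>c \<le> M\<close> in the second factor makes the bound linear in the slice size, so
    that summation over slices recovers \<open>card S\<close>.\<close>
  have slice_IH: "real m * (real (card (slice a)) * real M powr (- 1 / m)) \<le>
                  (\<Sum>j\<in>I. real (card (proj_away j (slice a))))" if "a \<in> V" for a
  proof -
    let ?c = "real (card (slice a))"
    have ne: "slice a \<noteq> {}"
      using that by (auto simp: slice_def V_def)
    have ext: "slice a \<subseteq> extensional I"
      using S(3) by (auto simp: slice_def extensional_def)
    have c: "?c > 0" using ne fin_slice by (simp add: card_gt_0_iff)
    have "real M powr (- 1 / m) \<le> ?c powr (- 1 / m)"
      using c slice_le[of a] m by (intro powr_mono2') auto
    then have "?c * real M powr (- 1 / m) \<le> ?c * ?c powr (- 1 / m)"
      by (intro mult_left_mono) auto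
    also have "\<dots> = ?c powr (1 - 1 / m)"
      using c powr_add[of ?c 1 "- 1 / m"] by simp
    finally show ?thesis
      using insert.IH[OF fin_slice ne ext] mult_left_mono[of _ "?c powr (1 - 1 / m)" "real m"]
      unfolding m_def by (meson of_nat_0_le_iff order_trans)
  qed
  have M: "M > 0" using S by (auto simp: M_def card_gt_0_iff)
  have s: "card S > 0" using S by (auto simp: card_gt_0_iff)
  define A where "A = real (card S) * real M powr (- 1 / m)"
  have "real m * A = (\<Sum>a\<in>V. real m * (real (card (slice a)) * real M powr (- 1 / m)))"
    by (simp add: A_def card_S sum_distrib_left sum_distrib_right)
  also have "\<dots> \<le> (\<Sum>a\<in>V. \<Sum>j\<in>I. real (card (proj_away j (slice a))))"
    by (intro sum_mono slice_IH)
  also have "\<dots> = (\<Sum>j\<in>I. \<Sum>a\<in>V. real (card (proj_away j (slice a))))"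
    by (rule sum.swap)
  also have "\<dots> = (\<Sum>j\<in>I. real (card (proj_away j S)))"
    by (intro sum.cong) (simp_all add: proj_slices)
  finally have le: "real m * A \<le> \<dots>" .
  \<comment> \<open>By the choice of \<open>A\<close> the powers of \<open>M\<close> cancel: the
    target is the geometric mean of \<open>A\<close> and \<open>M\<close> with weights
    \<open>m/(m+1)\<close> and \<open>1/(m+1)\<close>, which Young's inequality bounds by the
    arithmetic mean.\<close>
  have "real (card S) powr (1 - 1 / real (m + 1)) = A powr (m / (m + 1)) * real M powr (1 / (m + 1))"
  proof -
    have "A powr (m / (m + 1)) = real (card S) powr (m / (m + 1)) * real M powr (- 1 / (m + 1))"
      using m unfolding A_def by (simp add: powr_mult powr_powr)
    moreover have "real M powr (- 1 / (m + 1)) * real M powr (1 / (m + 1)) = 1"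
      using M by (simp flip: powr_add)
    moreover have "1 - 1 / real (m + 1) = m / (m + 1)"
      by (simp add: field_simps)
    ultimately show ?thesis by simp
  qed
  also have "\<dots> \<le> m / (m + 1) * A + 1 / (m + 1) * real M"
    by (rule Youngs_inequality_0) (use M s m in \<open>auto simp: A_def field_simps\<close>)
  also have "\<dots> = (m * A + M) / real (m + 1)"
    by (simp add: add_divide_distrib)
  finally have "real (m + 1) * real (card S) powr (1 - 1 / real (m + 1)) \<le> m * A + M"
    by (subst (asm) pos_le_divide_eq) (simp, simp only: mult.commute)
  moreover define P where "P j = real (card (proj_away j S))" for j
  moreover have "real m * A \<le> (\<Sum>j\<in>I. P j)"
    using le by (simp only: P_def)
  ultimately have "real (card (insert i I)) * real (card S) powr (1 - 1 / real (card (insert i I))) \<le>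
      (\<Sum>j\<in>insert i I. P j)"
    using insert.hyps by (simp add: m_def M_def)
  then show ?case by (simp only: P_def)
qed

section \<open>Boundary edges of sets in the torus\<close>

lemma torus_add_unit_vec:
  assumes "u \<in> torus k n" "i < k"
  shows "torus_add k n u (unit_vec k n i) = u(i := (u i + 1) mod n)"
proof
  fix j
  show "torus_add k n u (unit_vec k n i) j = (u(i := (u i + 1) mod n)) j"
    using assms by (auto simp: torus_def torus_add_def unit_vec_def PiE_iff extensional_def mod_simps)
qed

text \<open>A cyclic line in direction \<open>i\<close> that meets \<open>S\<close> has an exit edge
  unless \<open>S\<close> contains all its \<open>n\<close> points, and there are at most
  \<open>card S / n\<close> such full lines.\<close>

lemma card_torus_boundary_ge:
  assumes "0 < n" "S \<subseteq> torus k n" "i < k"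
  shows "real (card (proj_away i S)) - card S / n \<le>
         card {u \<in> S. torus_add k n u (unit_vec k n i) \<notin> S}"
proof -
  define B where "B = {u \<in> S. torus_add k n u (unit_vec k n i) \<notin> S}"
  define F where "F p = {u \<in> S. u(i := undefined) = p}" for p
  have fin: "finite S"
    using assms(2) by (rule finite_subset) (simp add: torus_def finite_PiE)
  then have finB: "finite B" and finF: "finite (F p)" for p
    by (simp_all add: B_def F_def)
  have fibre: "1 \<le> real (card {u \<in> B. u(i := undefined) = p}) + card (F p) / n"
    if p: "p \<in> proj_away i S" for p
  proof (cases "{u \<in> B. u(i := undefined) = p} = {}")
    case False
    then have "card {u \<in> B. u(i := undefined) = p} \<ge> 1"
      using finB by (simp add: Suc_le_eq card_gt_0_iff)
    then show ?thesis
      by (smt (verit) divide_nonneg_nonneg of_nat_0_le_iff real_of_nat_ge_one_iff)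
  next
    case True
    obtain u where u: "u \<in> S" "u(i := undefined) = p" using p by auto
    \<comment> \<open>Without an exit, the walk from \<open>u\<close> along its cyclic line never
      leaves \<open>S\<close>.\<close>
    have step: "u(i := (u i + t) mod n) \<in> S" for t
    proof (induction t)
      case 0
      have "u i < n" using u assms by (auto simp: torus_def)
      then show ?case using u by simp
    next
      case (Suc t)
      define w where "w = u(i := (u i + t) mod n)"
      have w: "w \<in> S" "w i = (u i + t) mod n" "w(i := v) = u(i := v)" for v
        using Suc by (simp_all only: w_def fun_upd_same fun_upd_upd)
      have "w(i := undefined) = p" using u w(3) by simp
      then have "w \<notin> B" using True by blast
      then have "torus_add k n w (unit_vec k n i) \<in> S"
        using w(1) unfolding B_def by blast
      moreover have "torus_add k n w (unit_vec k n i) = u(i := (u i + Suc t) mod n)"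
        using torus_add_unit_vec[OF subsetD[OF assms(2) w(1)] assms(3)] w by (simp add: mod_simps)
      ultimately show ?case by (simp only:)
    qed
    have "u(i := v) \<in> F p" if "v < n" for v
    proof -
      have "u i < n" using u assms by (auto simp: torus_def)
      \<comment> \<open>Going past the wraparound reaches \<open>v\<close> in a nonnegative number
        of steps even if \<open>v < u i\<close>.\<close>
      then have "(u i + (n - u i + v)) mod n = v" using that by simp
      then show ?thesis using step[of "n - u i + v"] u by (simp add: F_def)
    qed
    then have "(\<lambda>v. u(i := v)) ` {..<n} \<subseteq> F p" by auto
    moreover have "inj_on (\<lambda>v. u(i := v)) {..<n}"
      by (rule inj_onI) (metis fun_upd_same)
    ultimately have "n \<le> card (F p)"
      using card_inj_on_le[OF _ _ finF] by fastforce
    then have "1 \<le> card (F p) / n" using assms(1) by simp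
    then show ?thesis by (smt (verit) of_nat_0_le_iff)
  qed
  have "real (card (proj_away i S)) = (\<Sum>p\<in>proj_away i S. 1)" by simp
  also have "\<dots> \<le> (\<Sum>p\<in>proj_away i S. real (card {u \<in> B. u(i := undefined) = p}) + card (F p) / n)"
    by (intro sum_mono fibre)
  also have "\<dots> = (\<Sum>p\<in>proj_away i S. real (card {u \<in> B. u(i := undefined) = p})) + card S / n"
    using card_eq_sum_fibres[OF fin, of "\<lambda>u. u(i := undefined)"]
    by (simp add: sum.distrib F_def sum_divide_distrib)
  also have "(\<Sum>p\<in>proj_away i S. real (card {u \<in> B. u(i := undefined) = p})) =
             (\<Sum>p\<in>proj_away i B. real (card {u \<in> B. u(i := undefined) = p}))"
  proof (rule sum.mono_neutral_right)
    show "\<forall>p\<in>proj_away i S - proj_away i B. real (card {u \<in> B. u(i := undefined) = p}) = 0"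
    proof
      fix p assume "p \<in> proj_away i S - proj_away i B"
      then have "{u \<in> B. u(i := undefined) = p} = {}" by blast
      then show "real (card {u \<in> B. u(i := undefined) = p}) = 0"
        by (simp only: card.empty of_nat_0)
    qed
    show "proj_away i B \<subseteq> proj_away i S"
      by (rule image_mono) (auto simp: B_def)
  qed (use fin in simp)
  also have "\<dots> = card B"
    using card_eq_sum_fibres[OF finB, of "\<lambda>u. u(i := undefined)"] by simp
  finally show ?thesis unfolding B_def by linarith
qed

text \<open>Each point is charged according to the size \<open>c\<close> of its own level set. Over
  that set the charges add up to \<open>k * (c powr (1 - 1/k) - c/n)\<close>, which is what
  Loomis-Whitney, less the full lines, provides in boundary edges.\<close>

lemma torus_cut_edges_ge:
  fixes g :: "(nat \<Rightarrow> nat) \<Rightarrow> 'o"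
  assumes "0 < n" "0 < k"
  shows "(\<Sum>r\<in>torus k n. real k * (real (card {s \<in> torus k n. g s = g r}) powr (- 1 / k) - 1 / n)) \<le>
         (\<Sum>i<k. real (card {r \<in> torus k n. g r \<noteq> g (torus_add k n r (unit_vec k n i))}))"
proof -
  let ?T = "torus k n"
  let ?e = "unit_vec k n"
  define L where "L v = {r \<in> ?T. g r = v}" for v
  have fin: "finite ?T" by (simp add: torus_def finite_PiE)
  have closed: "torus_add k n u v \<in> ?T" for u v
    using assms by (auto simp: torus_def torus_add_def)
  have level: "real (card (L v)) * (real k * (real (card (L v)) powr (- 1 / k) - 1 / n)) \<le>
               (\<Sum>i<k. real (card {u \<in> L v. torus_add k n u (?e i) \<notin> L v}))" if "v \<in> g ` ?T" for v
  proof -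
    let ?c = "real (card (L v))"
    have ne: "L v \<noteq> {}" using that by (auto simp: L_def)
    have finL: "finite (L v)" using fin by (simp add: L_def)
    have c: "?c > 0" using ne finL by (simp add: card_gt_0_iff)
    have "?c * (real k * (?c powr (- 1 / k) - 1 / n)) = real k * (?c powr (1 - 1 / k)) - real k * (?c / n)"
      using c powr_add[of ?c 1 "- 1 / k"] by (simp add: algebra_simps)
    also have "\<dots> \<le> (\<Sum>i<k. real (card (proj_away i (L v)))) - (\<Sum>i<k. ?c / n)"
      using loomis_whitney_sum[of "{..<k}" "L v"] finL ne assms
      by (auto simp: L_def torus_def PiE_def subset_iff)
    also have "\<dots> = (\<Sum>i<k. real (card (proj_away i (L v))) - ?c / n)"
      by (rule sum_subtractf[symmetric])
    also have "\<dots> \<le> (\<Sum>i<k. real (card {u \<in> L v. torus_add k n u (?e i) \<notin> L v}))"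
      by (intro sum_mono card_torus_boundary_ge) (use assms in \<open>auto simp: L_def\<close>)
    finally show ?thesis .
  qed
  have "(\<Sum>r\<in>?T. real k * (real (card (L (g r))) powr (- 1 / k) - 1 / n)) =
        (\<Sum>v\<in>g ` ?T. \<Sum>r\<in>L v. real k * (real (card (L (g r))) powr (- 1 / k) - 1 / n))"
    unfolding L_def by (rule sum.image_gen[OF fin])
  also have "\<dots> = (\<Sum>v\<in>g ` ?T. real (card (L v)) * (real k * (real (card (L v)) powr (- 1 / k) - 1 / n)))"
  proof (rule sum.cong[OF refl])
    fix v
    have "(\<Sum>r\<in>L v. real k * (real (card (L (g r))) powr (- 1 / k) - 1 / n)) =
          (\<Sum>r\<in>L v. real k * (real (card (L v)) powr (- 1 / k) - 1 / n))"
      by (rule sum.cong) (auto simp: L_def)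
    then show "(\<Sum>r\<in>L v. real k * (real (card (L (g r))) powr (- 1 / k) - 1 / n)) =
       real (card (L v)) * (real k * (real (card (L v)) powr (- 1 / k) - 1 / n))"
      by simp
  qed
  also have "\<dots> \<le> (\<Sum>v\<in>g ` ?T. \<Sum>i<k. real (card {u \<in> L v. torus_add k n u (?e i) \<notin> L v}))"
    by (intro sum_mono level)
  also have "\<dots> = (\<Sum>i<k. \<Sum>v\<in>g ` ?T. real (card {u \<in> L v. torus_add k n u (?e i) \<notin> L v}))"
    by (rule sum.swap)
  also have "\<dots> = (\<Sum>i<k. real (card {r \<in> ?T. g r \<noteq> g (torus_add k n r (?e i))}))"
  proof (rule sum.cong[OF refl])
    fix i
    let ?C = "\<lambda>r. g r \<noteq> g (torus_add k n r (?e i))"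
    have "real (card {r \<in> ?T. ?C r}) = (\<Sum>r\<in>?T. of_bool (?C r))"
      using fin by (simp add: Int_def)
    also have "\<dots> = (\<Sum>v\<in>g ` ?T. \<Sum>r\<in>L v. of_bool (?C r))"
      unfolding L_def by (rule sum.image_gen[OF fin])
    also have "\<dots> = (\<Sum>v\<in>g ` ?T. real (card {u \<in> L v. torus_add k n u (?e i) \<notin> L v}))"
    proof (rule sum.cong[OF refl])
      fix v
      \<comment> \<open>Leaving a level set is the same as changing the label, so each cut edge is
        counted once, at its starting point.\<close>
      have "{u \<in> L v. torus_add k n u (?e i) \<notin> L v} = {u \<in> L v. ?C u}"
        using closed by (auto simp: L_def)
      moreover have "finite (L v)"
        using fin by (simp add: L_def)
      ultimately show "(\<Sum>r\<in>L v. of_bool (?C r)) = real (card {u \<in> L v. torus_add k n u (?e i) \<notin> L v})"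
        by (simp add: Int_def)
    qed
    finally show "(\<Sum>v\<in>g ` ?T. real (card {u \<in> L v. torus_add k n u (?e i) \<notin> L v})) =
      real (card {r \<in> ?T. ?C r})" by simp
  qed
  finally show ?thesis by (simp add: L_def)
qed

subsection \<open>Level sets of the hash function\<close>

lemma query_functions_certificate:
  assumes "h \<in> query_functions k n b d"
  obtains Q where "certificate (inputs k n b) h Q"
    "\<And>x. x \<in> inputs k n b \<Longrightarrow> Q x \<subseteq> torus k n"
    "\<And>x. x \<in> inputs k n b \<Longrightarrow> card (Q x) \<le> d"
proof -
  obtain A where A: "\<And>x. x \<in> inputs k n b \<Longrightarrow> run A x = h x"
    "\<And>x. x \<in> inputs k n b \<Longrightarrow> set (query_seq A x) \<subseteq> torus k n"
    "\<And>x. x \<in> inputs k n b \<Longrightarrow> length (query_seq A x) \<le> d"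
    using assms unfolding query_functions_def by blast
  show ?thesis
  proof (rule that[of "\<lambda>x. set (query_seq A x)"])
    show "certificate (inputs k n b) h (\<lambda>x. set (query_seq A x))"
      unfolding certificate_def
    proof (intro ballI impI)
      fix x z assume "x \<in> inputs k n b" "z \<in> inputs k n b" "\<forall>i\<in>set (query_seq A x). z i = x i"
      then show "h z = h x \<and> set (query_seq A z) = set (query_seq A x)"
        using query_seq_cong[of A x z] A(1) by metis
    qed
    show "card (set (query_seq A x)) \<le> d" if "x \<in> inputs k n b" for x
      using A(3)[OF that] card_length le_trans by blast
  qed (use A in blast)
qed

lemma query_functions_range:
  "h \<in> query_functions k n b d \<Longrightarrow> x \<in> inputs k n b \<Longrightarrow> h x \<in> torus k n"
  by (auto simp: query_functions_def)

text \<open>The label of \<open>r\<close>: the answer of \<open>h\<close> is relative to the shifted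
  view, and adding \<open>r\<close> makes it absolute. An error-free \<open>h\<close> would give all
  points the same label.\<close>

definition location :: "nat \<Rightarrow> nat \<Rightarrow> (input \<Rightarrow> (nat \<Rightarrow> nat)) \<Rightarrow> input \<Rightarrow> (nat \<Rightarrow> nat) \<Rightarrow> (nat \<Rightarrow> nat)" where
  "location k n h x r = torus_add k n (h (shift k n x r)) r"

text \<open>Position \<open>u\<close> of the shifted input holds the entry of \<open>x\<close> at
  \<open>u + r\<close>, so the certificate is translated by \<open>r\<close>.\<close>

lemma certificate_location:
  assumes n: "0 < n" and cert: "certificate (inputs k n b) h Q"
    and Q: "\<And>x. x \<in> inputs k n b \<Longrightarrow> Q x \<subseteq> torus k n"
  shows "certificate (inputs k n b) (\<lambda>x. location k n h x r)
           (\<lambda>x. (\<lambda>u. torus_add k n u r) ` Q (shift k n x r))"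
  unfolding certificate_def
proof (intro ballI impI)
  fix x z assume x: "x \<in> inputs k n b" and z: "z \<in> inputs k n b"
    and agree: "\<forall>i\<in>(\<lambda>u. torus_add k n u r) ` Q (shift k n x r). z i = x i"
  have "shift k n z r i = shift k n x r i" if "i \<in> Q (shift k n x r)" for i
    using agree that Q[OF shift_inputs[OF n x]] by (auto simp: shift_def)
  with certificateD[OF cert shift_inputs[OF n x] shift_inputs[OF n z]]
  show "location k n h z r = location k n h x r \<and>
    (\<lambda>u. torus_add k n u r) ` Q (shift k n z r) = (\<lambda>u. torus_add k n u r) ` Q (shift k n x r)"
    unfolding location_def by metis
qed

text \<open>Since \<open>h x\<close> is the label of the origin, this bounds the total size of the
  origin's level set over all inputs. After decoupling, \<open>x\<close> and \<open>y\<close> are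
  fixed and the shifts \<open>r\<close> are counted.\<close>

lemma sum_location_coincidences_le:
  assumes n: "0 < n" and h: "h \<in> query_functions k n b d"
  shows "(\<Sum>r\<in>torus k n. card {x \<in> inputs k n b. h x = location k n h x r}) \<le>
         (d\<^sup>2 + 1) * card (inputs k n b)"
proof -
  let ?X = "inputs k n b" and ?T = "torus k n"
  let ?add = "torus_add k n"
  obtain Q where cert: "certificate ?X h Q"
    and QT: "\<And>x. x \<in> ?X \<Longrightarrow> Q x \<subseteq> ?T" and Qd: "\<And>x. x \<in> ?X \<Longrightarrow> card (Q x) \<le> d"
    using query_functions_certificate[OF h] by blast
  have finQ: "finite (Q x)" if "x \<in> ?X" for x
    using QT[OF that] finite_torus by (rule finite_subset)
  \<comment> \<open>A translation is determined by one point and its image. This serves twice: for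
    two queries that meet and for two labels that agree.\<close>
  have few_shifts: "card {r \<in> ?T. c = ?add u r} \<le> 1" for c u
  proof -
    have "\<forall>r\<in>{r \<in> ?T. c = ?add u r}. \<forall>s\<in>{r \<in> ?T. c = ?add u r}. r = s"
    proof (intro ballI)
      fix r s assume r: "r \<in> {r \<in> ?T. c = ?add u r}" and s: "s \<in> {r \<in> ?T. c = ?add u r}"
      then have "?add u r = ?add u s" by simp
      then show "r = s" using torus_add_left_cancel[OF n, of r k s u] r s by blast
    qed
    then show ?thesis
      using card_le_Suc0_iff_eq[of "{r \<in> ?T. c = ?add u r}"] finite_torus[of k n] by simp
  qed
  have collisions: "card {r \<in> ?T. Q x \<inter> (\<lambda>u. ?add u r) ` Q y \<noteq> {}} \<le> d\<^sup>2"
    if x: "x \<in> ?X" and y: "y \<in> ?X" for x y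
  proof -
    let ?S = "\<lambda>p. {r \<in> ?T. fst p = ?add (snd p) r}"
    have "card {r \<in> ?T. Q x \<inter> (\<lambda>u. ?add u r) ` Q y \<noteq> {}} \<le> card (\<Union>p\<in>Q x \<times> Q y. ?S p)"
      by (rule card_mono) (use finite_torus finQ x y in auto)
    also have "\<dots> \<le> (\<Sum>p\<in>Q x \<times> Q y. card (?S p))"
      by (rule card_UN_le) (use finQ x y in auto)
    also have "\<dots> \<le> (\<Sum>p\<in>Q x \<times> Q y. 1)"
      by (rule sum_mono) (rule few_shifts)
    also have "\<dots> = card (Q x) * card (Q y)"
      by (simp add: card_cartesian_product)
    also have "\<dots> \<le> d\<^sup>2"
      unfolding power2_eq_square by (rule mult_mono) (use Qd x y in auto)
    finally show ?thesis .
  qed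
  \<comment> \<open>Once \<open>y\<close> is summed independently of \<open>x\<close>, its shift by
    \<open>r\<close> can be undone; \<open>r\<close> then survives only as an explicit
    translation.\<close>
  have translate: "(\<Sum>y\<in>?X. f (shift k n y r)) = (\<Sum>y\<in>?X. f y)" for f :: "input \<Rightarrow> nat" and r
    using sum.reindex_bij_betw[OF bij_betw_shift[OF n], of f k r b] .
  have "(\<Sum>r\<in>?T. card {x \<in> ?X. h x = location k n h x r}) * card ?X =
        (\<Sum>r\<in>?T. card {x \<in> ?X. h x = location k n h x r} * card ?X)"
    by (rule sum_distrib_right)
  also have "\<dots> \<le> (\<Sum>r\<in>?T. (\<Sum>x\<in>?X. \<Sum>y\<in>?X. of_bool (Q x \<inter> (\<lambda>u. ?add u r) ` Q (shift k n y r) \<noteq> {})) +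
                            (\<Sum>x\<in>?X. \<Sum>y\<in>?X. of_bool (h x = location k n h y r)))"
    by (intro sum_mono coincidence_le[of "torus k n" "\<lambda>_. {w. length w = b}" h Q, folded inputs_def]
          finite_inputs cert certificate_location[OF n cert QT])
  also have "\<dots> = (\<Sum>r\<in>?T. \<Sum>x\<in>?X. \<Sum>y\<in>?X.
      of_bool (Q x \<inter> (\<lambda>u. ?add u r) ` Q y \<noteq> {}) + of_bool (h x = ?add (h y) r))"
    unfolding location_def sum.distrib
    using translate[of "\<lambda>y. of_bool (Q x \<inter> (\<lambda>u. ?add u r) ` Q y \<noteq> {})" r for x r]
      translate[of "\<lambda>y. of_bool (h x = ?add (h y) r)" r for x r]
    by (simp only:)
  also have "\<dots> = (\<Sum>x\<in>?X. \<Sum>y\<in>?X. \<Sum>r\<in>?T.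
      of_bool (Q x \<inter> (\<lambda>u. ?add u r) ` Q y \<noteq> {}) + of_bool (h x = ?add (h y) r))"
    by (subst sum.swap, intro sum.cong refl, rule sum.swap)
  also have "\<dots> = (\<Sum>x\<in>?X. \<Sum>y\<in>?X.
      card {r \<in> ?T. Q x \<inter> (\<lambda>u. ?add u r) ` Q y \<noteq> {}} + card {r \<in> ?T. h x = ?add (h y) r})"
    using finite_torus[of k n] by (simp add: sum.distrib Int_def)
  also have "\<dots> \<le> (\<Sum>x\<in>?X. \<Sum>y\<in>?X. d\<^sup>2 + 1)"
    by (intro sum_mono add_mono collisions few_shifts)
  also have "\<dots> = (d\<^sup>2 + 1) * card ?X * card ?X"
    by (simp add: algebra_simps)
  finally show ?thesis
    using finite_inputs[of k n b] inputs_nonempty[of k n b] by (simp add: card_gt_0_iff)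
qed

text \<open>The labels of \<open>x\<close> around \<open>r\<close> are those of the shifted input
  around the origin, all translated by \<open>r\<close>, and translation is injective. Comparisons
  at any point thus reduce to comparisons at the origin.\<close>

lemma location_add:
  assumes n: "0 < n" and h: "h \<in> query_functions k n b d" and x: "x \<in> inputs k n b"
  shows "location k n h x r = location k n h x (torus_add k n r t) \<longleftrightarrow>
         h (shift k n x r) = location k n h (shift k n x r) t"
proof -
  have "location k n h x (torus_add k n r t) = torus_add k n (location k n h (shift k n x r) t) r"
    unfolding location_def shift_shift[OF n]
    by (simp add: torus_add_assoc torus_add_commute[of k n r t])
  moreover have "h (shift k n x r) \<in> torus k n" "location k n h (shift k n x r) t \<in> torus k n"
    using query_functions_range[OF h shift_inputs[OF n x]] torus_add_closed[OF n]
    by (simp_all add: location_def)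
  ultimately show ?thesis
    using torus_add_right_cancel[OF n] by (simp add: location_def)
qed

text \<open>Shifting permutes the inputs, so every \<open>r\<close> contributes as much as the
  origin, whose level set is already bounded.\<close>

lemma sum_card_level_sets_le:
  assumes n: "0 < n" and h: "h \<in> query_functions k n b d"
  shows "(\<Sum>x\<in>inputs k n b. \<Sum>r\<in>torus k n.
            card {s \<in> torus k n. location k n h x s = location k n h x r}) \<le>
         (d\<^sup>2 + 1) * card (inputs k n b) * card (torus k n)"
proof -
  let ?X = "inputs k n b" and ?T = "torus k n"
  let ?loc = "location k n h" and ?add = "torus_add k n"
  have level: "card {s \<in> ?T. ?loc x s = ?loc x r} =
      (\<Sum>t\<in>?T. of_bool (h (shift k n x r) = ?loc (shift k n x r) t))" if x: "x \<in> ?X" for x r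
  proof -
    have "card {s \<in> ?T. ?loc x s = ?loc x r} = (\<Sum>s\<in>?T. of_bool (?loc x r = ?loc x s))"
      using finite_torus[of k n] by (simp add: Int_def eq_commute)
    also have "\<dots> = (\<Sum>t\<in>?T. of_bool (?loc x r = ?loc x (?add r t)))"
      using sum.reindex_bij_betw[OF bij_betw_torus_add[OF n, of k r], of "\<lambda>s. of_bool (?loc x r = ?loc x s) :: nat"]
      by (simp only: torus_add_commute[of k n r])
    finally show ?thesis
      by (simp only: location_add[OF n h x])
  qed
  have "(\<Sum>x\<in>?X. \<Sum>r\<in>?T. card {s \<in> ?T. ?loc x s = ?loc x r}) =
        (\<Sum>r\<in>?T. \<Sum>x\<in>?X. \<Sum>t\<in>?T. of_bool (h (shift k n x r) = ?loc (shift k n x r) t))"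
    by (subst sum.swap, intro sum.cong refl, rule level)
  also have "\<dots> = (\<Sum>r\<in>?T. \<Sum>x\<in>?X. \<Sum>t\<in>?T. of_bool (h x = ?loc x t))"
    by (intro sum.cong refl sum.reindex_bij_betw[OF bij_betw_shift[OF n], of "\<lambda>x. \<Sum>t\<in>?T. of_bool (h x = ?loc x t)"])
  also have "\<dots> = card ?T * (\<Sum>t\<in>?T. \<Sum>x\<in>?X. of_bool (h x = ?loc x t))"
    by (subst sum.swap) simp
  also have "\<dots> = card ?T * (\<Sum>t\<in>?T. card {x \<in> ?X. h x = ?loc x t})"
    using finite_inputs[of k n b] by (simp add: Int_def)
  also have "\<dots> \<le> card ?T * ((d\<^sup>2 + 1) * card ?X)"
    by (rule mult_le_mono2[OF sum_location_coincidences_le[OF n h]])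
  finally show ?thesis by (simp only: mult.commute mult.left_commute)
qed

subsection \<open>The lower bound\<close>

text \<open>A convex function lies above its tangent, here taken at \<open>s = D\<close>. Averaged
  over \<open>s\<close>, this takes the place of Jensen's inequality.\<close>

lemma powr_ge_tangent:
  fixes a :: real
  assumes "0 < s" "0 < D" "0 \<le> a"
  shows "s powr (- a) \<ge> D powr (- a) * (1 - a * (s / D - 1))"
proof -
  have "1 - a * (s / D - 1) \<le> 1 - a * ln (s / D)"
    using assms ln_le_minus_one[of "s / D"] by (simp add: mult_left_mono)
  also have "\<dots> \<le> (s / D) powr (- a)"
    using exp_ge_add_one_self[of "- a * ln (s / D)"] assms by (simp add: powr_def)
  finally have "D powr (- a) * (1 - a * (s / D - 1)) \<le> D powr (- a) * (s / D) powr (- a)"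
    by (intro mult_left_mono) auto
  also have "\<dots> = s powr (- a)"
    using assms by (simp add: powr_divide)
  finally show ?thesis .
qed

text \<open>Cut edges over all inputs are bounded below by isoperimetry and counted exactly by shift
  invariance. The directions are summed because a level set that is long in one direction may have
  few boundary edges there.\<close>

lemma sum_failures_ge:
  assumes n: "0 < n" and k: "0 < k" and h: "h \<in> query_functions k n b d"
  shows "real k * (real (d\<^sup>2 + 1) powr (- 1 / k) - 1 / n) \<le>
    (\<Sum>i<k. measure_pmf.prob (pmf_of_set (inputs k n b))
       {x. h x \<noteq> torus_add k n (h (shift k n x (unit_vec k n i))) (unit_vec k n i)})"
proof -
  let ?X = "inputs k n b" and ?T = "torus k n"
  let ?loc = "location k n h" and ?e = "unit_vec k n"
  let ?size = "\<lambda>x r. real (card {s \<in> ?T. ?loc x s = ?loc x r})"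
  let ?fail = "\<lambda>i. {x \<in> ?X. h x \<noteq> ?loc x (?e i)}"
  define D where "D = real (d\<^sup>2 + 1)"
  define N where "N = real (card ?X)"
  define V where "V = real (card ?T)"
  have D: "D > 0" by (simp add: D_def add_pos_nonneg)
  have N: "N > 0" using finite_inputs inputs_nonempty by (simp add: N_def card_gt_0_iff)
  have V: "V > 0"
    using finite_torus[of k n] torus_add_closed[OF n, of k] unfolding V_def
    by (metis card_gt_0_iff empty_iff of_nat_0_less_iff)
  have "(\<Sum>x\<in>?X. \<Sum>r\<in>?T. ?size x r) \<le> D * N * V"
    using of_nat_mono[OF sum_card_level_sets_le[OF n h], where 'a = real]
    by (simp only: D_def N_def V_def of_nat_sum of_nat_mult)
  then have avg: "(\<Sum>x\<in>?X. \<Sum>r\<in>?T. ?size x r) / D \<le> N * V"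
    using D by (simp add: divide_le_eq mult_ac)
  \<comment> \<open>\<open>D\<close> only bounds the mean level-set size from above. As the tangent
    has negative slope, a smaller mean can only improve the bound.\<close>
  have "N * V * D powr (- 1 / k) \<le>
      D powr (- 1 / k) * (N * V - 1 / k * ((\<Sum>x\<in>?X. \<Sum>r\<in>?T. ?size x r) / D - N * V))"
  proof -
    have "1 / k * ((\<Sum>x\<in>?X. \<Sum>r\<in>?T. ?size x r) / D - N * V) \<le> 0"
      by (rule mult_nonneg_nonpos) (use avg in auto)
    then show ?thesis
      by (subst mult.commute) (intro mult_left_mono, auto)
  qed
  also have "\<dots> = (\<Sum>x\<in>?X. \<Sum>r\<in>?T. D powr (- 1 / k) * (1 - 1 / k * (?size x r / D - 1)))"
    by (simp add: N_def V_def sum_distrib_left[symmetric] sum_subtractf sum_divide_distrib[symmetric])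
  also have "\<dots> \<le> (\<Sum>x\<in>?X. \<Sum>r\<in>?T. ?size x r powr (- 1 / k))"
  proof (intro sum_mono)
    fix x r assume "r \<in> ?T"
    then have "?size x r > 0" using finite_torus by (auto simp: card_gt_0_iff)
    then show "D powr (- 1 / k) * (1 - 1 / k * (?size x r / D - 1)) \<le> ?size x r powr (- 1 / k)"
      using powr_ge_tangent[of "?size x r" D "1 / k"] D by simp
  qed
  finally have sizes: "N * V * D powr (- 1 / k) \<le> (\<Sum>x\<in>?X. \<Sum>r\<in>?T. ?size x r powr (- 1 / k))" .
  \<comment> \<open>By shift invariance, each of the \<open>V\<close> base points starts a cut edge
    in direction \<open>i\<close> for equally many inputs, namely as many as make \<open>h\<close>
    fail.\<close>
  have cut: "(\<Sum>x\<in>?X. real (card {r \<in> ?T. ?loc x r \<noteq> ?loc x (torus_add k n r (?e i))})) = V * card (?fail i)" for i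
  proof -
    have "(\<Sum>x\<in>?X. real (card {r \<in> ?T. ?loc x r \<noteq> ?loc x (torus_add k n r (?e i))})) =
          (\<Sum>x\<in>?X. \<Sum>r\<in>?T. of_bool (?loc x r \<noteq> ?loc x (torus_add k n r (?e i))))"
      using finite_torus[of k n] by (simp add: Int_def)
    also have "\<dots> = (\<Sum>x\<in>?X. \<Sum>r\<in>?T. of_bool (h (shift k n x r) \<noteq> ?loc (shift k n x r) (?e i)))"
      by (intro sum.cong refl) (simp only: location_add[OF n h])
    also have "\<dots> = (\<Sum>r\<in>?T. \<Sum>x\<in>?X. of_bool (h (shift k n x r) \<noteq> ?loc (shift k n x r) (?e i)))"
      by (rule sum.swap)
    also have "\<dots> = (\<Sum>r\<in>?T. \<Sum>x\<in>?X. of_bool (h x \<noteq> ?loc x (?e i)))"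
      by (intro sum.cong refl sum.reindex_bij_betw[OF bij_betw_shift[OF n], of "\<lambda>x. of_bool (h x \<noteq> ?loc x (?e i))"])
    also have "\<dots> = V * card (?fail i)"
      using finite_inputs[of k n b] by (simp add: Int_def V_def)
    finally show ?thesis .
  qed
  have "N * V * (real k * (D powr (- 1 / k) - 1 / n)) = real k * (N * V * D powr (- 1 / k)) - real k * (N * V / n)"
    by (simp add: algebra_simps)
  also have "\<dots> \<le> real k * (\<Sum>x\<in>?X. \<Sum>r\<in>?T. ?size x r powr (- 1 / k)) - real k * (N * V / n)"
    using sizes by (intro diff_right_mono mult_left_mono) auto
  also have "\<dots> = (\<Sum>x\<in>?X. \<Sum>r\<in>?T. real k * (?size x r powr (- 1 / k) - 1 / n))"
    by (simp add: N_def V_def sum_distrib_left[symmetric] sum_subtractf right_diff_distrib)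
  also have "\<dots> \<le> (\<Sum>x\<in>?X. \<Sum>i<k. real (card {r \<in> ?T. ?loc x r \<noteq> ?loc x (torus_add k n r (?e i))}))"
    by (intro sum_mono torus_cut_edges_ge n k)
  also have "\<dots> = (\<Sum>i<k. V * card (?fail i))"
    by (subst sum.swap) (simp only: cut)
  also have "\<dots> = N * V * (\<Sum>i<k. card (?fail i) / N)"
    using N by (simp add: sum_distrib_left)
  finally have "real k * (D powr (- 1 / k) - 1 / n) \<le> (\<Sum>i<k. card (?fail i) / N)"
    using N V by simp
  also have "\<dots> = (\<Sum>i<k. measure_pmf.prob (pmf_of_set ?X) {x. h x \<noteq> torus_add k n (h (shift k n x (?e i))) (?e i)})"
    by (simp add: measure_pmf_of_set finite_inputs inputs_nonempty Int_def location_def N_def)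
  finally show ?thesis by (simp only: D_def)
qed

section \<open>Mixtures of deterministic hash functions\<close>

lemma finite_query_functions: "finite (query_functions k n b d)"
proof (rule finite_subset)
  show "query_functions k n b d \<subseteq> inputs k n b \<rightarrow>\<^sub>E torus k n"
    by (auto simp: query_functions_def)
qed (simp add: finite_PiE finite_inputs finite_torus)

lemma prob_pair_pmf_finite:
  assumes "finite (set_pmf A)"
  shows "measure_pmf.prob (pair_pmf A B) S =
         (\<Sum>a\<in>set_pmf A. pmf A a * measure_pmf.prob B {y. (a, y) \<in> S})"
proof -
  have "emeasure (pair_pmf A B) S = (\<integral>\<^sup>+a. \<integral>\<^sup>+y. indicator S (a, y) \<partial>B \<partial>A)"
    by (simp flip: nn_integral_pair_pmf')
  also have "\<dots> = (\<integral>\<^sup>+a. emeasure B {y. (a, y) \<in> S} \<partial>A)"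
    by (intro nn_integral_cong) (simp flip: nn_integral_indicator add: indicator_def)
  also have "\<dots> = (\<Sum>a\<in>set_pmf A. emeasure B {y. (a, y) \<in> S} * pmf A a)"
    by (rule nn_integral_measure_pmf_finite[OF assms]) simp
  also have "\<dots> = (\<Sum>a\<in>set_pmf A. ennreal (pmf A a * measure_pmf.prob B {y. (a, y) \<in> S}))"
    by (intro sum.cong refl)
       (simp add: measure_pmf.emeasure_eq_measure ennreal_mult mult.commute)
  also have "\<dots> = ennreal (\<Sum>a\<in>set_pmf A. pmf A a * measure_pmf.prob B {y. (a, y) \<in> S})"
    by (rule sum_ennreal) simp
  finally show ?thesis
    by (simp add: measure_pmf.emeasure_eq_measure sum_nonneg)
qed

text \<open>A function in the support of \<open>H\<close> may do well in one direction at the cost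
  of another, so the deterministic bound is averaged over \<open>H\<close> as a sum over directions;
  only then is \<open>\<delta>\<close> inserted for each direction.\<close>

lemma LPHS_error_ge:
  assumes n: "0 < n" and k: "0 < k" and H: "LPHS k n b d \<delta> H"
  shows "\<delta> \<ge> real (d\<^sup>2 + 1) powr (- 1 / k) - 1 / n"
proof -
  let ?E = "\<lambda>i. {(h, x). h x \<noteq> torus_add k n (h (shift k n x (unit_vec k n i))) (unit_vec k n i)}"
  let ?U = "pmf_of_set (inputs k n b)"
  let ?q = "\<lambda>h i. measure_pmf.prob ?U {x. (h, x) \<in> ?E i}"
  let ?c = "real (d\<^sup>2 + 1) powr (- 1 / k) - 1 / n"
  have sub: "set_pmf H \<subseteq> query_functions k n b d"
    and le: "\<And>i. i < k \<Longrightarrow> measure_pmf.prob (pair_pmf H ?U) (?E i) \<le> \<delta>"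
    using H by (auto simp: LPHS_def)
  have fin: "finite (set_pmf H)"
    using sub finite_query_functions by (rule finite_subset)
  have "real k * ?c = (\<Sum>h\<in>set_pmf H. pmf H h * (real k * ?c))"
    using sum_pmf_eq_1[OF fin order_refl] by (simp flip: sum_distrib_right)
  also have "\<dots> \<le> (\<Sum>h\<in>set_pmf H. pmf H h * (\<Sum>i<k. ?q h i))"
    by (intro sum_mono mult_left_mono) (use sum_failures_ge[OF n k] sub in auto)
  also have "\<dots> = (\<Sum>i<k. \<Sum>h\<in>set_pmf H. pmf H h * ?q h i)"
    by (simp only: sum_distrib_left) (rule sum.swap)
  also have "\<dots> = (\<Sum>i<k. measure_pmf.prob (pair_pmf H ?U) (?E i))"
    by (simp only: prob_pair_pmf_finite[OF fin])
  also have "\<dots> \<le> (\<Sum>i<k. \<delta>)"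
    by (intro sum_mono le) auto
  finally have "real k * ?c \<le> real k * \<delta>" by simp
  then show ?thesis using k by simp
qed

theorem theorem3:
  "\<exists>C c :: real. C > 0 \<and> c > 0 \<and>
     (\<forall>(k::nat) (d::nat) (n::nat) (b::nat) (\<delta>::real) (H :: (input \<Rightarrow> (nat \<Rightarrow> nat)) pmf).
        k \<ge> 1 \<longrightarrow> d \<ge> 1 \<longrightarrow> real n \<ge> C * real d powr (2 / real k) \<longrightarrow>
        LPHS k n b d \<delta> H \<longrightarrow>
        \<delta> \<ge> c * real d powr (- 2 / real k))"
proof (rule exI[of _ 4], rule exI[of _ "1 / 4"], intro conjI allI impI)
  \<comment> \<open>With \<open>p = d powr (2/k)\<close> the main term is at least
    \<open>1/(2*p)\<close>. The witness \<open>4\<close> makes the loss \<open>1/n\<close> at most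
    half of that, which leaves \<open>1/(4*p)\<close> and explains the witness
    \<open>1/4\<close>.\<close>
  fix k d n b :: nat and \<delta> :: real and H :: "(input \<Rightarrow> (nat \<Rightarrow> nat)) pmf"
  assume k: "k \<ge> 1" and d: "d \<ge> 1" and le: "real n \<ge> 4 * real d powr (2 / real k)"
    and H: "LPHS k n b d \<delta> H"
  define p where "p = real d powr (2 / real k)"
  have p: "p > 0" using d by (simp add: p_def)
  have inv: "real d powr (- 2 / real k) = 1 / p"
    by (simp add: p_def powr_minus_divide)
  have "real n > 0" using le p unfolding p_def by linarith
  then have n: "n > 0" by simp
  have "1 / n \<le> 1 / (4 * p)"
    using le p n by (intro divide_left_mono) (auto simp: p_def)
  moreover have "real (d\<^sup>2 + 1) powr (- 1 / k) \<ge> 1 / (2 * p)"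
  proof -
    \<comment> \<open>From \<open>d \<ge> 1\<close>, \<open>d^2 + 1\<close> is at most
      \<open>2 * d^2\<close>; the resulting factor \<open>2 powr (-1/k)\<close> is at least
      \<open>1/2\<close> for every \<open>k \<ge> 1\<close>, which keeps the constants independent
      of \<open>k\<close>.\<close>
    have "(1::nat) \<le> d\<^sup>2" using d by simp
    then have "real (d\<^sup>2 + 1) \<le> 2 * (real d)\<^sup>2"
      by (simp flip: of_nat_power)
    then have "(2 * (real d)\<^sup>2) powr (- 1 / k) \<le> real (d\<^sup>2 + 1) powr (- 1 / k)"
      by (intro powr_mono2') auto
    moreover have "(2 * (real d)\<^sup>2) powr (- 1 / k) = 2 powr (- 1 / k) * (1 / p)"
    proof -
      have "(real d)\<^sup>2 powr (- 1 / k) = real d powr (- 2 / k)"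
        using d by (simp add: powr_powr flip: powr_numeral)
      then show ?thesis using inv by (simp add: powr_mult)
    qed
    moreover have "(2::real) powr (- 1 / k) \<ge> 2 powr (- 1)"
      using k by (intro powr_mono) (auto simp: field_simps)
    then have "2 powr (- 1 / k) * (1 / p) \<ge> 1 / 2 * (1 / p)"
      using p by (intro mult_right_mono) (auto simp: powr_minus_divide)
    ultimately show ?thesis by simp
  qed
  moreover have "\<delta> \<ge> real (d\<^sup>2 + 1) powr (- 1 / k) - 1 / n"
    using LPHS_error_ge[OF n _ H] k by simp
  ultimately have "\<delta> \<ge> 1 / (2 * p) - 1 / (4 * p)" by linarith
  also have "1 / (2 * p) - 1 / (4 * p) = 1 / 4 * (1 / p)"
    using p by (simp add: field_simps)
  finally show "\<delta> \<ge> 1 / 4 * real d powr (- 2 / real k)"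
    by (simp only: inv)
qed auto

end
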